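(* Let $H$ be a tournament. If there exists a sparse $H$-useful family of tournaments, then $t(n,H)=n(\log n)^{O(1)}$.
   Context: $H$ is fixed and $n\to\infty$. A tournament is a digraph having exactly one of the edges $(u,v),(v,u)$ for every pair of distinct vertices $u,v$. A semi-complete digraph is a digraph obtained from a tournament by adding some (possibly zero) edges, i.e. every pair of distinct vertices is joined by at least one of the two possible edges; a pair $\{u,v\}$ is bidirectional if both $(u,v)$ and $(v,u)$ are edges. A digraph contains a copy of $H$ if it has a (not necessarily induced) subgraph isomorphic to $H$, and is $H$-free otherwise. For $n\ge|V(H)|$, $t(n,H)$ is the smallest integer $t$ such that adding any $t$ new edges (reversals of existing edges) to any $n$-vertex tournament results in a digraph containing a copy of $H$. Expanders: an undirected graph $U=(V,E)$ is a $d$-expander if for every $S\subseteq V$ of size $1\le |S|\le |V|/2$ there are at least $d|S|$ edges connecting $S$ to $V\setminus S$. A semi-complete digraph is a $d$-expander if the undirected graph on the same vertex set formed by its bidirectional pairs is a $d$-expander. Random tournaments: for a semi-complete digraph $F$, ${\cal D}_F$ is the distribution over tournaments obtained from $F$ by picking independently and uniformly, for each bidirectional pair $\{i,j\}$ of $F$, either the edge $(i,j)$ or the edge $(j,i)$ (all other edges of $F$ are kept). Sparse: a family of tournaments ${\cal Q}$ is sparse if there is a constant $b$ such that for every $n$-vertex semi-complete digraph $F$ which is a $b\log^b n$-expander, $\mathbb{P}_{G\sim{\cal D}_F}[G\in{\cal Q}]<1/2$. Here $\log^b n=(\log n)^b$. Prime: a homogeneous set of a tournament $G=(V,E)$ is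 a set $X\subseteq V$ such that for every $v\in V\setminus X$, either $(v,x)\in E$ for all $x\in X$ or $(x,v)\in E$ for all $x\in X$. It is nontrivial if $1<|X|<|V|$, and otherwise trivial. A tournament is prime if all of its homogeneous sets are trivial. $H$-useful: a family of tournaments ${\cal Q}$ is $H$-useful if every prime tournament which is $H$-free belongs to ${\cal Q}$. *)

theory Defs
  imports
    "Graph_Theory.Graph_Theory"
    "HOL-Probability.Probability"
begin

text \<open>
  Digraphs are finite and loopless, without parallel arcs: the locale
  \<^locale>\<open>pair_digraph\<close>, with arcs represented as ordered pairs of vertices.
\<close>

definition tournament :: "'a pair_pre_digraph \<Rightarrow> bool" where
  "tournament G \<longleftrightarrow> pair_digraph G \<and>
     (\<forall>u\<in>pverts G. \<forall>v\<in>pverts G. u \<noteq> v \<longrightarrow> ((u, v) \<in> parcs G) \<noteq> ((v, u) \<in> parcs G))"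

definition semicomplete :: "'a pair_pre_digraph \<Rightarrow> bool" where
  "semicomplete G \<longleftrightarrow> pair_digraph G \<and>
     (\<forall>u\<in>pverts G. \<forall>v\<in>pverts G. u \<noteq> v \<longrightarrow> (u, v) \<in> parcs G \<or> (v, u) \<in> parcs G)"

definition bidirectional_pairs :: "'a pair_pre_digraph \<Rightarrow> 'a set set" where
  "bidirectional_pairs G = {{u, v} | u v. (u, v) \<in> parcs G \<and> (v, u) \<in> parcs G}"

definition contains_copy :: "'a pair_pre_digraph \<Rightarrow> 'b pair_pre_digraph \<Rightarrow> bool" where
  "contains_copy G H \<longleftrightarrow>
     (\<exists>K :: 'a pair_pre_digraph. subgraph (with_proj K) (with_proj G) \<and>
        digraph_iso (with_proj H) (with_proj K))"

text \<open>
  The new arcs form a set \<open>A\<close> of reversals of arcs of \<open>T\<close>. If \<open>t\<close> exceeds \<open>n choose 2\<close>, the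
  condition on \<open>t\<close> is vacuous; this does not affect the minimum when \<open>H\<close> is a tournament and
  \<open>n\<close> is at least the number of its vertices, since the complete digraph obtained for
  \<open>t = n choose 2\<close> contains a copy of \<open>H\<close>. For smaller \<open>n\<close> the value is irrelevant.
\<close>

definition t_number :: "nat \<Rightarrow> 'a pair_pre_digraph \<Rightarrow> nat" where
  "t_number n H = (LEAST t. \<forall>(T :: nat pair_pre_digraph) A.
     tournament T \<and> card (pverts T) = n \<and> A \<subseteq> (parcs T)\<inverse> \<and> card A = t \<longrightarrow>
     contains_copy (T\<lparr>parcs := parcs T \<union> A\<rparr>) H)"

text \<open>Undirected graphs are given by a vertex set \<open>V\<close> and a set \<open>U\<close> of two-element subsets.\<close>

definition graph_expander :: "real \<Rightarrow> 'a set \<Rightarrow> 'a set set \<Rightarrow> bool" where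
  "graph_expander d V U \<longleftrightarrow>
     (\<forall>S\<subseteq>V. 1 \<le> card S \<and> real (card S) \<le> real (card V) / 2 \<longrightarrow>
        d * real (card S) \<le> real (card {e \<in> U. \<exists>x\<in>S. \<exists>y\<in>V - S. e = {x, y}}))"

definition expander :: "real \<Rightarrow> 'a pair_pre_digraph \<Rightarrow> bool" where
  "expander d F \<longleftrightarrow> graph_expander d (pverts F) (bidirectional_pairs F)"

definition random_tournament :: "'a pair_pre_digraph \<Rightarrow> 'a pair_pre_digraph pmf" where
  "random_tournament F =
     map_pmf (\<lambda>c. F\<lparr>parcs := {(u, v) \<in> parcs F. (v, u) \<notin> parcs F} \<union> c ` bidirectional_pairs F\<rparr>)
       (Pi_pmf (bidirectional_pairs F) undefined (\<lambda>e. pmf_of_set {(u, v). {u, v} = e}))"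

text \<open>
  A family of tournaments is a set of tournaments with vertices in \<^typ>\<open>nat\<close>, which represents
  every isomorphism type; it need not be closed under isomorphism.

  In the definition of sparseness, digraphs on one vertex (and the empty one) are excluded: they
  are vacuously \<open>d\<close>-expanders for every \<open>d\<close>, and the one-vertex tournament is prime and does not
  contain any tournament with at least two vertices. Logarithms are to base 2.
  With these conventions every \<open>b (log n)\<^sup>b\<close>-expander has more than \<open>b\<close> vertices, so
  enlarging \<open>b\<close> discards any given finite range of \<open>n\<close>, and also absorbs a change of base:
  the definition agrees with the one that demands the bound only for all sufficiently large \<open>n\<close>.
\<close>

definition sparse_family :: "nat pair_pre_digraph set \<Rightarrow> bool" where
  "sparse_family Q \<longleftrightarrow> (\<exists>b>0. \<forall>F n.
     semicomplete F \<and> card (pverts F) = n \<and> n \<ge> 2 \<and> expander (b * log 2 (real n) powr b) F \<longrightarrow>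
     measure_pmf.prob (random_tournament F) Q < 1 / 2)"

definition homogeneous :: "'a pair_pre_digraph \<Rightarrow> 'a set \<Rightarrow> bool" where
  "homogeneous G X \<longleftrightarrow> X \<subseteq> pverts G \<and>
     (\<forall>v\<in>pverts G - X. (\<forall>x\<in>X. (v, x) \<in> parcs G) \<or> (\<forall>x\<in>X. (x, v) \<in> parcs G))"

definition prime_tournament :: "'a pair_pre_digraph \<Rightarrow> bool" where
  "prime_tournament G \<longleftrightarrow> tournament G \<and>
     (\<forall>X. homogeneous G X \<longrightarrow> \<not> (1 < card X \<and> card X < card (pverts G)))"

definition useful :: "'a pair_pre_digraph \<Rightarrow> nat pair_pre_digraph set \<Rightarrow> bool" where
  "useful H Q \<longleftrightarrow> (\<forall>G. prime_tournament G \<and> \<not> contains_copy G H \<longrightarrow> G \<in> Q)"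

end

theory Submission
  imports Defs "HOL-Real_Asymp.Real_Asymp"
begin

text \<open>
  Let \<open>F\<close> be obtained from a tournament on \<open>n\<close> vertices by adding more than \<open>d n log n\<close> arcs,
  where \<open>d\<close> is a large power of \<open>log n\<close>. Its bidirectional pairs form a graph with that many
  edges, and such a graph has an induced \<open>d\<close>-expander on some vertex set \<open>W\<close> with at least two
  vertices: otherwise one could keep splitting vertex sets along sparse cuts down to single
  vertices, and charging the cut edges to the smaller side accounts for at most \<open>d n log n\<close> edges
  (\<open>edges_le_if_no_expander\<close>). So \<open>F\<close> may be replaced by the semi-complete digraph \<open>G\<close> that it
  induces on \<open>W\<close>.

  Orient the bidirectional pairs of \<open>G\<close> at random. A fixed vertex set \<open>X\<close> becomes homogeneous
  only if, for each vertex \<open>v\<close> outside, the pairs between \<open>v\<close> and \<open>X\<close> all get the same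
  direction, which costs a factor exponential in the number of bidirectional pairs leaving \<open>X\<close>
  (\<open>prob_homogeneous_le\<close>). By expansion that number is at least \<open>d\<close> times the size of the smaller
  of \<open>X\<close> and its complement, and \<open>d\<close> exceeds \<open>2 log n\<close>, so a union bound over all \<open>X\<close> shows that
  the outcome is prime with probability more than one half (\<open>prob_not_prime_less_half\<close>).
  By sparseness the outcome also avoids the given family with probability more than one half.
  Hence some outcome is prime and outside the family; as the family is useful for \<open>H\<close>, this
  outcome contains \<open>H\<close>, and it is a subgraph of \<open>F\<close>.
\<close>

section \<open>Expanding induced subgraphs\<close>

definition cut :: "'a set set \<Rightarrow> 'a set \<Rightarrow> 'a set \<Rightarrow> 'a set set" where
  "cut U V S = {e \<in> U. \<exists>x\<in>S. \<exists>y\<in>V - S. e = {x, y}}"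

lemma graph_expander_mono:
  assumes "graph_expander d V U" "d' \<le> d"
  shows "graph_expander d' V U"
  unfolding graph_expander_def
proof (intro allI impI)
  fix S assume S: "S \<subseteq> V" "1 \<le> card S \<and> real (card S) \<le> real (card V) / 2"
  have "d' * real (card S) \<le> d * real (card S)"
    using assms(2) by (simp add: mult_right_mono)
  also have "\<dots> \<le> real (card {e \<in> U. \<exists>x\<in>S. \<exists>y\<in>V - S. e = {x, y}})"
    using assms(1) S unfolding graph_expander_def by blast
  finally show "d' * real (card S) \<le> real (card {e \<in> U. \<exists>x\<in>S. \<exists>y\<in>V - S. e = {x, y}})" .
qed

lemma cut_complement:
  assumes "S \<subseteq> V"
  shows "cut U V (V - S) = cut U V S"
proof -
  have "V - (V - S) = S" using assms by blast
  then show ?thesis unfolding cut_def by (auto simp: insert_commute)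
qed

text \<open>
  Induction on \<open>V\<close>. A set \<open>S\<close> violating expansion splits \<open>V\<close> so that fewer than \<open>d s\<close> edges
  cross, where \<open>s\<close> is the size of \<open>S\<close>. Since \<open>s\<close> is at most half the size of \<open>V\<close>, every vertex of
  \<open>S\<close> moves to a set at most half as large and thus has a budget of \<open>d\<close> to spend on the cut; this
  can happen to it at most \<open>log |V|\<close> times.
\<close>

lemma edges_le_if_no_expander:
  assumes "finite V" and two: "\<And>e. e \<in> U \<Longrightarrow> card e = 2" and "0 \<le> d"
    and "\<forall>W\<subseteq>V. 2 \<le> card W \<longrightarrow> \<not> graph_expander d W {e \<in> U. e \<subseteq> W}"
  shows "real (card {e \<in> U. e \<subseteq> V}) \<le> d * real (card V) * log 2 (real (card V))"
  using assms(1,4)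
proof (induction "card V" arbitrary: V rule: less_induct)
  case less
  let ?E = "\<lambda>W. {e \<in> U. e \<subseteq> W}"
  have finE: "finite (?E W)" if "W \<subseteq> V" for W
    using less.prems(1) that by (auto intro: finite_subset[of _ "Pow V"])
  show ?case
  proof (cases "2 \<le> card V")
    case False
    have "?E V = {}"
    proof (rule ccontr)
      assume "?E V \<noteq> {}"
      then obtain e where "e \<in> U" "e \<subseteq> V" by blast
      then have "2 \<le> card V" using two[of e] card_mono[OF less.prems(1), of e] by simp
      then show False using False by simp
    qed
    moreover have "card V = 0 \<or> card V = 1" using False by linarith
    then have "real (card V) * log 2 (real (card V)) = 0" by (elim disjE) simp_all
    ultimately show ?thesis by (simp only: mult.assoc) simp
  next
    case True
    then have "\<not> graph_expander d V (?E V)" using less.prems(2) by blast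
    then obtain S where S: "S \<subseteq> V" "1 \<le> card S" "real (card S) \<le> real (card V) / 2"
      and few: "real (card (cut (?E V) V S)) < d * real (card S)"
      unfolding graph_expander_def cut_def not_all not_imp not_le by blast
    define n s where "n = real (card V)" and "s = real (card S)"
    have finS: "finite S" using S(1) less.prems(1) finite_subset by blast
    have n2: "n \<ge> 2" and s1: "s \<ge> 1" and sn: "s \<le> n / 2"
      using True S by (simp_all add: n_def s_def)
    have diff: "real (card (V - S)) = n - s"
      using S(1) less.prems(1) finS
      by (simp add: n_def s_def card_Diff_subset card_mono of_nat_diff)
    have "card S < card V" "card (V - S) < card V"
      using n2 s1 sn diff by (simp_all add: n_def s_def)
    then have IH: "real (card (?E S)) \<le> d * s * log 2 s"
      "real (card (?E (V - S))) \<le> d * (n - s) * log 2 (n - s)"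
      using less.hyps[of S] less.hyps[of "V - S"] less.prems S(1) finS
      unfolding diff s_def by (auto simp: diff[unfolded s_def])
    have sub: "?E V \<subseteq> ?E S \<union> ?E (V - S) \<union> cut (?E V) V S"
    proof
      fix e assume e: "e \<in> ?E V"
      then obtain x y where "e = {x, y}" using two[of e] by (auto simp: card_2_iff)
      then show "e \<in> ?E S \<union> ?E (V - S) \<union> cut (?E V) V S"
        using e S(1) unfolding cut_def by blast
    qed
    have "finite (cut (?E V) V S)"
      by (rule finite_subset[of _ "?E V"]) (use finE[of V] in \<open>simp_all add: cut_def\<close>, blast)
    then have "finite (?E S \<union> ?E (V - S) \<union> cut (?E V) V S)"
      using finE[OF S(1)] finE[of "V - S"] by simp
    from card_mono[OF this sub]
    have "card (?E V) \<le> card (?E S \<union> ?E (V - S) \<union> cut (?E V) V S)" .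
    also have "\<dots> \<le> card (?E S) + card (?E (V - S)) + card (cut (?E V) V S)"
      using card_Un_le[of "?E S \<union> ?E (V - S)" "cut (?E V) V S"] card_Un_le[of "?E S" "?E (V - S)"]
      by linarith
    finally have "real (card (?E V)) \<le>
        real (card (?E S)) + real (card (?E (V - S))) + real (card (cut (?E V) V S))"
      by linarith
    also have "\<dots> \<le> d * (s * log 2 s) + d * ((n - s) * log 2 (n - s)) + d * s"
      using IH few by (simp add: s_def mult.assoc)
    also have "\<dots> = d * (s * log 2 s + (n - s) * log 2 (n - s) + s)"
      by (simp add: algebra_simps)
    also have "\<dots> \<le> d * (n * log 2 n)"
    proof (rule mult_left_mono[OF _ assms(3)])
      \<comment> \<open>The smaller side loses one unit of the logarithm, which pays for the cut edges.\<close>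
      have "log 2 s \<le> log 2 (n / 2)" using s1 sn by simp
      also have "\<dots> = log 2 n - 1" using n2 by (simp add: log_divide)
      finally have "s * log 2 s \<le> s * (log 2 n - 1)" using s1 by simp
      moreover have "(n - s) * log 2 (n - s) \<le> (n - s) * log 2 n"
        using s1 sn n2 by (intro mult_left_mono) auto
      ultimately show "s * log 2 s + (n - s) * log 2 (n - s) + s \<le> n * log 2 n"
        by (simp add: algebra_simps)
    qed
    finally show ?thesis by (simp add: n_def mult.assoc)
  qed
qed

section \<open>Random orientations of the bidirectional pairs\<close>

text \<open>
  The distribution of random tournaments is split into the coin flips and the digraph that they
  determine, because events are estimated on the independent flips.
\<close>

definition coins :: "'a pair_pre_digraph \<Rightarrow> ('a set \<Rightarrow> 'a \<times> 'a) pmf" where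
  "coins F = Pi_pmf (bidirectional_pairs F) undefined (\<lambda>e. pmf_of_set {(u, v). {u, v} = e})"

definition orient ::
    "'a pair_pre_digraph \<Rightarrow> ('a set \<Rightarrow> 'a \<times> 'a) \<Rightarrow> 'a pair_pre_digraph" where
  "orient F c =
     F\<lparr>parcs := {(u, v) \<in> parcs F. (v, u) \<notin> parcs F} \<union> c ` bidirectional_pairs F\<rparr>"

lemma random_tournament_eq: "random_tournament F = map_pmf (orient F) (coins F)"
  by (simp add: random_tournament_def orient_def[abs_def] coins_def)

lemma semicomplete_arcs:
  assumes "semicomplete F"
  shows "finite (pverts F)" "finite (parcs F)"
    and "(u, v) \<in> parcs F \<Longrightarrow> u \<in> pverts F \<and> v \<in> pverts F \<and> u \<noteq> v"
    and "u \<in> pverts F \<Longrightarrow> v \<in> pverts F \<Longrightarrow> u \<noteq> v \<Longrightarrow> (u, v) \<in> parcs F \<or> (v, u) \<in> parcs F"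
proof -
  interpret pair_digraph F using assms by (simp add: semicomplete_def)
  show "finite (pverts F)" "finite (parcs F)"
    using pair_finite_verts pair_finite_arcs by auto
  show "(u, v) \<in> parcs F \<Longrightarrow> u \<in> pverts F \<and> v \<in> pverts F \<and> u \<noteq> v"
    using arc_fst_in_verts arc_snd_in_verts pair_no_loops by fastforce
  show "u \<in> pverts F \<Longrightarrow> v \<in> pverts F \<Longrightarrow> u \<noteq> v \<Longrightarrow> (u, v) \<in> parcs F \<or> (v, u) \<in> parcs F"
    using assms by (auto simp: semicomplete_def)
qed

lemma pair_digraphI:
  assumes "finite (pverts G)" "parcs G \<subseteq> pverts G \<times> pverts G" "\<And>v. (v, v) \<notin> parcs G"
  shows "pair_digraph G"
proof
  show "finite (parcs G)" using assms(1,2) finite_subset by blast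
  show "fst e \<noteq> snd e" if "e \<in> parcs G" for e using assms(3) that by (cases e) auto
qed (use assms in auto)

lemma bidirectional_pairs_iff:
  "{u, v} \<in> bidirectional_pairs F \<longleftrightarrow> (u, v) \<in> parcs F \<and> (v, u) \<in> parcs F"
  unfolding bidirectional_pairs_def by (auto simp: doubleton_eq_iff)

lemma bidirectional_pairs_card:
  assumes "semicomplete F" "e \<in> bidirectional_pairs F"
  shows "card e = 2" "e \<subseteq> pverts F"
proof -
  obtain u v where "e = {u, v}" "(u, v) \<in> parcs F"
    using assms(2) by (auto simp: bidirectional_pairs_def)
  then show "card e = 2" "e \<subseteq> pverts F" using semicomplete_arcs(3)[OF assms(1)] by auto
qed

lemma finite_bidirectional_pairs:
  assumes "semicomplete F"
  shows "finite (bidirectional_pairs F)"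
  using semicomplete_arcs(1)[OF assms] bidirectional_pairs_card(2)[OF assms]
  by (auto intro: finite_subset[of _ "Pow (pverts F)"])

lemma orderings_of_pair: "{(a, b). {a, b} = {u, v}} = {(u, v), (v, u)}"
  by (auto simp: doubleton_eq_iff)

text \<open>
  The probability space contains functions that send a pair to an unrelated arc. The lemmas about
  the arcs of oriented digraphs therefore speak of outcomes of positive probability only.
\<close>

lemma coins_support:
  assumes F: "semicomplete F" and c: "c \<in> set_pmf (coins F)"
    and e: "{u, v} \<in> bidirectional_pairs F"
  shows "c {u, v} = (u, v) \<or> c {u, v} = (v, u)"
proof -
  have "c {u, v} \<in> set_pmf (pmf_of_set {(a, b). {a, b} = {u, v}})"
    using c e unfolding coins_def set_Pi_pmf[OF finite_bidirectional_pairs[OF F]]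
    by (auto simp: PiE_dflt_def)
  then show ?thesis unfolding orderings_of_pair by simp
qed

lemma orient_arc_iff:
  assumes F: "semicomplete F" and c: "c \<in> set_pmf (coins F)"
  shows "(u, v) \<in> parcs (orient F c) \<longleftrightarrow>
    (if {u, v} \<in> bidirectional_pairs F then c {u, v} = (u, v) else (u, v) \<in> parcs F)"
proof -
  have "(u, v) \<in> c ` bidirectional_pairs F \<longleftrightarrow>
      {u, v} \<in> bidirectional_pairs F \<and> c {u, v} = (u, v)"
  proof
    assume "(u, v) \<in> c ` bidirectional_pairs F"
    then obtain e where e: "e \<in> bidirectional_pairs F" "c e = (u, v)" by auto
    obtain x y where xy: "e = {x, y}" using e(1) by (auto simp: bidirectional_pairs_def)
    then have "e = {u, v}" using coins_support[OF F c, of x y] e by auto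
    then show "{u, v} \<in> bidirectional_pairs F \<and> c {u, v} = (u, v)" using e by simp
  qed (metis image_eqI)
  then show ?thesis unfolding orient_def by (auto simp: bidirectional_pairs_iff)
qed

lemma pverts_orient [simp]: "pverts (orient F c) = pverts F"
  by (simp add: orient_def)

lemma tournament_orient:
  assumes F: "semicomplete F" and c: "c \<in> set_pmf (coins F)"
  shows "tournament (orient F c)" "parcs (orient F c) \<subseteq> parcs F"
proof -
  note arc = orient_arc_iff[OF F c]
  show sub: "parcs (orient F c) \<subseteq> parcs F"
    by (auto simp: arc bidirectional_pairs_iff split: if_splits)
  have "pair_digraph (orient F c)"
    using sub semicomplete_arcs[OF F] by (intro pair_digraphI) auto
  moreover have "((u, v) \<in> parcs (orient F c)) \<noteq> ((v, u) \<in> parcs (orient F c))"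
    if "u \<in> pverts F" "v \<in> pverts F" "u \<noteq> v" for u v
    using that semicomplete_arcs(4)[OF F that] coins_support[OF F c, of u v]
    unfolding arc by (auto simp: insert_commute bidirectional_pairs_iff)
  ultimately show "tournament (orient F c)" unfolding tournament_def pverts_orient by blast
qed

lemma prob_coins_agree:
  assumes F: "semicomplete F" and K: "K \<subseteq> bidirectional_pairs F"
  shows "measure_pmf.prob (coins F) {c. \<forall>e\<in>K. c e = f e} \<le> (1 / 2) ^ card K"
proof -
  let ?U = "bidirectional_pairs F"
  note fin = finite_bidirectional_pairs[OF F]
  let ?B = "\<lambda>e. if e \<in> K then {f e} else UNIV"
  have "{c. \<forall>e\<in>K. c e = f e} = Pi ?U ?B"
    using K by (auto simp: Pi_iff split: if_splits)
  then have "measure_pmf.prob (coins F) {c. \<forall>e\<in>K. c e = f e} =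
      (\<Prod>e\<in>?U. measure_pmf.prob (pmf_of_set {(u, v). {u, v} = e}) (?B e))"
    unfolding coins_def by (simp add: measure_Pi_pmf_Pi[OF fin])
  also have "\<dots> \<le> (\<Prod>e\<in>?U. if e \<in> K then 1 / 2 else 1)"
  proof (rule prod_mono, intro conjI)
    fix e assume e: "e \<in> ?U"
    then obtain u v where uv: "e = {u, v}" "u \<noteq> v"
      using bidirectional_pairs_card(1)[OF F e] by (auto simp: card_2_iff)
    show "measure_pmf.prob (pmf_of_set {(u, v). {u, v} = e}) (?B e) \<le> (if e \<in> K then 1 / 2 else 1)"
      unfolding uv(1) orderings_of_pair using uv(2)
      by (auto simp: measure_pmf_single divide_simps indicator_def)
  qed simp
  also have "\<dots> = (1 / 2) ^ card K"
    using K fin by (simp add: prod.If_cases Int_absorb1)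
  finally show ?thesis .
qed

section \<open>Homogeneous sets of random orientations\<close>

text \<open>
  Let \<open>Y\<close> be the complement of \<open>X\<close> and \<open>k\<close> the number of bidirectional pairs between them.
  If \<open>X\<close> is homogeneous, then all \<open>k\<close> pairs are determined by the set of vertices of \<open>Y\<close> that
  dominate \<open>X\<close>. Only the vertices joined to every element of \<open>X\<close> by a bidirectional pair are
  free to choose: any other vertex has an arc to or from \<open>X\<close> that is fixed in \<open>F\<close> and dictates
  the direction. As \<open>X\<close> has at least two elements, each free vertex uses up two or more of the
  \<open>k\<close> pairs, so there are at most \<open>2\<close> to the power \<open>k / 2\<close> patterns, each of probability \<open>2\<close> to
  the power \<open>- k\<close>.
\<close>

lemma prob_homogeneous_le:
  assumes F: "semicomplete F" and X: "X \<subseteq> pverts F" "2 \<le> card X"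
  shows "measure_pmf.prob (coins F) {c. homogeneous (orient F c) X} \<le>
    (1 / 2) powr (real (card (cut (bidirectional_pairs F) (pverts F) X)) / 2)"
proof -
  define U Y K where "U = bidirectional_pairs F" and "Y = pverts F - X"
    and "K = cut U (pverts F) X"
  \<comment> \<open>The vertices that are free to choose, and those that must dominate \<open>X\<close>.\<close>
  define full where "full = {v \<in> Y. \<forall>x\<in>X. {v, x} \<in> U}"
  define forced where "forced = {v \<in> Y - full. \<exists>x\<in>X. (x, v) \<notin> parcs F}"
  \<comment> \<open>The orientation of the cut if the free vertices that dominate \<open>X\<close> are those in \<open>Z\<close>.\<close>
  define outcome where
    "outcome Z e = (let v = the_elem (e \<inter> Y); x = the_elem (e \<inter> X)
                    in if v \<in> Z \<union> forced then (v, x) else (x, v))" for Z e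
  have finV: "finite (pverts F)" by (rule semicomplete_arcs(1)[OF F])
  have fin: "finite U" "finite X" "finite Y" "finite full"
    using finite_bidirectional_pairs[OF F] finV X(1) finite_subset
    by (auto simp: U_def Y_def full_def)
  have KU: "K \<subseteq> U" by (auto simp: K_def cut_def)
  have cover: "{c. homogeneous (orient F c) X} \<inter> set_pmf (coins F) \<subseteq>
      (\<Union>Z\<in>Pow full. {c. \<forall>e\<in>K. c e = outcome Z e})"
  proof
    fix c assume "c \<in> {c. homogeneous (orient F c) X} \<inter> set_pmf (coins F)"
    then have hom: "homogeneous (orient F c) X" and c: "c \<in> set_pmf (coins F)" by auto
    note arc = orient_arc_iff[OF F c, folded U_def]
    define out where "out = {v \<in> Y. \<forall>x\<in>X. (v, x) \<in> parcs (orient F c)}"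
    have into: "(x, v) \<in> parcs (orient F c)" if "v \<in> Y" "v \<notin> out" "x \<in> X" for v x
      using hom that by (auto simp: homogeneous_def out_def Y_def)
    have forced: "v \<in> out \<longleftrightarrow> v \<in> forced" if v: "v \<in> Y" "v \<notin> full" for v
    proof
      assume "v \<in> out"
      obtain x where x: "x \<in> X" "{v, x} \<notin> U" using v by (auto simp: full_def)
      then have "(v, x) \<in> parcs F" using \<open>v \<in> out\<close> arc[of v x] by (auto simp: out_def)
      then have "(x, v) \<notin> parcs F" using x(2) by (auto simp: U_def bidirectional_pairs_iff)
      then show "v \<in> forced" using v x by (auto simp: forced_def)
    next
      assume "v \<in> forced"
      then obtain x where "x \<in> X" "(x, v) \<notin> parcs F" by (auto simp: forced_def)
      then show "v \<in> out" using into[OF v(1)] tournament_orient(2)[OF F c] by blast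
    qed
    have "c e = outcome (out \<inter> full) e" if eK: "e \<in> K" for e
    proof -
      obtain x v where "x \<in> X" "v \<in> Y" "e = {x, v}" and eU: "e \<in> U"
        using eK unfolding K_def cut_def Y_def by blast
      then have xv: "x \<in> X" "v \<in> Y" "e = {v, x}" by auto
      have "e \<inter> Y = {v}" "e \<inter> X = {x}" using xv by (auto simp: Y_def)
      then have oc: "outcome (out \<inter> full) e = (if v \<in> out then (v, x) else (x, v))"
        using forced[of v] xv(2) by (auto simp: outcome_def Let_def forced_def)
      show ?thesis
      proof (cases "v \<in> out")
        case True
        then have "(v, x) \<in> parcs (orient F c)" using xv(1) by (simp add: out_def)
        then show ?thesis using arc[of v x] eU xv(3) True oc by simp
      next
        case False
        have "(x, v) \<in> parcs (orient F c)" by (rule into[OF xv(2) False xv(1)])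
        then show ?thesis using arc[of x v] eU xv(3) False oc by (simp add: insert_commute)
      qed
    qed
    then show "c \<in> (\<Union>Z\<in>Pow full. {c. \<forall>e\<in>K. c e = outcome Z e})" by blast
  qed
  have "inj_on (\<lambda>(v, x). {v, x}) (full \<times> X)"
    by (auto simp: inj_on_def doubleton_eq_iff full_def Y_def)
  moreover have "(\<lambda>(v, x). {v, x}) ` (full \<times> X) \<subseteq> K"
    using X(1) by (auto simp: K_def cut_def full_def Y_def insert_commute)
  ultimately have "card (full \<times> X) \<le> card K"
    using fin(1) KU by (meson card_inj_on_le finite_subset)
  then have "card full * card X \<le> card K" by (simp add: card_cartesian_product)
  moreover have "card full * 2 \<le> card full * card X" using X(2) by simp
  ultimately have few: "2 * card full \<le> card K" by linarith
  have "measure_pmf.prob (coins F) {c. homogeneous (orient F c) X} =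
      measure_pmf.prob (coins F) ({c. homogeneous (orient F c) X} \<inter> set_pmf (coins F))"
    by (simp add: measure_Int_set_pmf)
  also have "\<dots> \<le> measure_pmf.prob (coins F) (\<Union>Z\<in>Pow full. {c. \<forall>e\<in>K. c e = outcome Z e})"
    using cover by (intro measure_pmf.finite_measure_mono) auto
  also have "\<dots> \<le> (\<Sum>Z\<in>Pow full. measure_pmf.prob (coins F) {c. \<forall>e\<in>K. c e = outcome Z e})"
    using fin(4) by (intro measure_pmf.finite_measure_subadditive_finite) auto
  also have "\<dots> \<le> (\<Sum>Z\<in>Pow full. (1 / 2) ^ card K)"
    using KU by (intro sum_mono prob_coins_agree[OF F]) (simp add: U_def)
  also have "\<dots> = 2 ^ card full / 2 ^ card K"
    using fin(4) by (simp add: card_Pow power_one_over)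
  also have "\<dots> = 2 powr (real (card full) - real (card K))"
    by (simp add: powr_diff powr_realpow)
  also have "\<dots> \<le> 2 powr (- (real (card K) / 2))"
    using few by (intro powr_mono) auto
  also have "\<dots> = (1 / 2) powr (real (card K) / 2)"
    by (simp add: powr_minus_divide powr_divide)
  finally show ?thesis by (simp add: K_def U_def)
qed

lemma sum_power_card_Pow:
  fixes q :: "'b :: comm_semiring_1"
  assumes "finite A"
  shows "(\<Sum>X\<in>Pow A. q ^ card X) = (1 + q) ^ card A"
  using prod_add[OF assms, of "\<lambda>_. q" "\<lambda>_. 1"] by (simp add: add.commute)

text \<open>
  Expansion is applied to the smaller of \<open>X\<close> and its complement, which have the same cut.
  The bound is stated as the sum of the two cases so that the union bound over \<open>X\<close> becomes two
  binomial sums.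
\<close>

lemma prob_homogeneous_le_expander:
  assumes F: "semicomplete F" and ex: "expander d F"
    and X: "X \<subseteq> pverts F" "2 \<le> card X" "card X < card (pverts F)"
  defines "q \<equiv> (1 / 2) powr (d / 2) :: real"
  shows "measure_pmf.prob (coins F) {c. homogeneous (orient F c) X} \<le>
    q ^ card X + q ^ card (pverts F - X)"
proof -
  let ?V = "pverts F" and ?U = "bidirectional_pairs F"
  have finV: "finite ?V" by (rule semicomplete_arcs(1)[OF F])
  have finX: "finite X" using X(1) finV finite_subset by blast
  have q0: "q > 0" by (simp add: q_def)
  have cX: "card (?V - X) = card ?V - card X" using X(1) finX by (simp add: card_Diff_subset)
  have bound: "(1 / 2) powr (real (card (cut ?U ?V X)) / 2) \<le> q ^ card S"
    if S: "S \<subseteq> ?V" "1 \<le> card S" "2 * card S \<le> card ?V" "cut ?U ?V S = cut ?U ?V X" for S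
  proof -
    have "d * real (card S) \<le> real (card (cut ?U ?V S))"
      using ex S unfolding expander_def graph_expander_def cut_def by auto
    then have "(1 / 2) powr (real (card (cut ?U ?V X)) / 2) \<le> (1 / 2 :: real) powr (d / 2 * real (card S))"
      using S(4) by (intro powr_mono') auto
    also have "\<dots> = q ^ card S"
      unfolding powr_powr[symmetric] by (simp add: q_def powr_realpow)
    finally show ?thesis .
  qed
  have "(1 / 2) powr (real (card (cut ?U ?V X)) / 2) \<le> q ^ card X + q ^ card (?V - X)"
  proof (cases "2 * card X \<le> card ?V")
    case True
    then have "(1 / 2) powr (real (card (cut ?U ?V X)) / 2) \<le> q ^ card X"
      using X by (intro bound) auto
    then show ?thesis using q0 by (smt (verit) zero_less_power)
  next
    case False
    then have "(1 / 2) powr (real (card (cut ?U ?V X)) / 2) \<le> q ^ card (?V - X)"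
      using X cX cut_complement[OF X(1)] by (intro bound) auto
    then show ?thesis using q0 by (smt (verit) zero_less_power)
  qed
  then show ?thesis using prob_homogeneous_le[OF F X(1,2)] by linarith
qed

text \<open>
  With \<open>q\<close> the probability factor per vertex, the union bound is at most twice
  \<open>(1 + q)\<^sup>n - 1\<close>. The hypothesis on \<open>d\<close> says that \<open>q \<le> 1 / (8 n)\<close>, and then \<open>(1 + q)\<^sup>n\<close> is at
  most \<open>exp (1 / 8)\<close>, which is less than \<open>5 / 4\<close>.
\<close>

lemma prob_not_prime_less_half:
  assumes F: "semicomplete F" and ne: "pverts F \<noteq> {}" and ex: "expander d F"
    and d: "2 * log 2 (real (card (pverts F))) + 6 \<le> d"
  shows "measure_pmf.prob (random_tournament F) {G. \<not> prime_tournament G} < 1 / 2"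
proof -
  let ?V = "pverts F"
  let ?P = "\<lambda>X. measure_pmf.prob (coins F) {c. homogeneous (orient F c) X}"
  define q :: real where "q = (1 / 2) powr (d / 2)"
  define n where "n = card ?V"
  define N where "N = {X. X \<subseteq> ?V \<and> 2 \<le> card X \<and> card X < n}"
  have finV: "finite ?V" by (rule semicomplete_arcs(1)[OF F])
  have finN: "finite N" using finV by (auto simp: N_def)
  have n0: "n > 0" using ne finV by (auto simp: n_def card_gt_0_iff)
  have q0: "q > 0" by (simp add: q_def)
  have "q \<le> (1 / 2) powr (log 2 n + 3)"
    unfolding q_def using d by (intro powr_mono') (auto simp: n_def)
  also have "\<dots> = 1 / (8 * real n)"
    using n0 by (simp add: powr_add powr_divide)
  finally have q: "real n * q \<le> 1 / 8" using n0 by (simp add: field_simps)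
  have "(1 + q) ^ n \<le> exp q ^ n"
    using q0 by (intro power_mono) (auto simp: exp_ge_add_one_self)
  also have "\<dots> = exp (real n * q)" by (simp add: exp_of_nat_mult)
  also have "\<dots> \<le> exp (1 / 8)" using q by simp
  also have "\<dots> < 5 / 4" using exp_bound[of "1 / 8"] by (simp add: power2_eq_square)
  finally have pow: "(1 + q) ^ n < 5 / 4" .
  have nonempty: "(\<Sum>X\<in>Pow ?V - {{}}. q ^ card X) = (1 + q) ^ n - 1"
    using sum_power_card_Pow[OF finV, of q] finV by (simp add: sum_diff1 n_def)
  have "(\<Sum>X\<in>N. q ^ card (?V - X)) = (\<Sum>X\<in>(\<lambda>X. ?V - X) ` N. q ^ card X)"
    by (subst sum.reindex) (auto simp: inj_on_def N_def)
  also have "\<dots> \<le> (1 + q) ^ n - 1"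
    unfolding nonempty[symmetric] using finV q0
    by (intro sum_mono2) (auto simp: N_def n_def dest: card_mono[OF finV])
  finally have large: "(\<Sum>X\<in>N. q ^ card (?V - X)) \<le> (1 + q) ^ n - 1" .
  have small: "(\<Sum>X\<in>N. q ^ card X) \<le> (1 + q) ^ n - 1"
    unfolding nonempty[symmetric] using finV q0
    by (intro sum_mono2) (auto simp: N_def)
  have "measure_pmf.prob (random_tournament F) {G. \<not> prime_tournament G} =
      measure_pmf.prob (coins F) ({c. \<not> prime_tournament (orient F c)} \<inter> set_pmf (coins F))"
    by (simp add: random_tournament_eq measure_Int_set_pmf vimage_def)
  also have "\<dots> \<le> measure_pmf.prob (coins F) (\<Union>X\<in>N. {c. homogeneous (orient F c) X})"
  proof (rule measure_pmf.finite_measure_mono)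
    show "{c. \<not> prime_tournament (orient F c)} \<inter> set_pmf (coins F) \<subseteq>
        (\<Union>X\<in>N. {c. homogeneous (orient F c) X})"
    proof
      fix c assume "c \<in> {c. \<not> prime_tournament (orient F c)} \<inter> set_pmf (coins F)"
      then obtain X where X: "homogeneous (orient F c) X" "1 < card X" "card X < n"
        using tournament_orient(1)[OF F, of c] by (auto simp: prime_tournament_def n_def)
      then have "X \<in> N" by (auto simp: N_def homogeneous_def)
      with X(1) show "c \<in> (\<Union>X\<in>N. {c. homogeneous (orient F c) X})" by blast
    qed
  qed simp
  also have "\<dots> \<le> (\<Sum>X\<in>N. ?P X)"
    using finN by (intro measure_pmf.finite_measure_subadditive_finite) auto
  also have "\<dots> \<le> (\<Sum>X\<in>N. q ^ card X + q ^ card (?V - X))"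
    unfolding q_def
    by (intro sum_mono prob_homogeneous_le_expander[OF F ex]) (auto simp: N_def n_def)
  also have "\<dots> \<le> 2 * ((1 + q) ^ n - 1)"
    using small large by (simp add: sum.distrib)
  finally show ?thesis using pow by simp
qed

section \<open>Copies in semi-complete digraphs\<close>

lemma contains_copy_mono:
  assumes "contains_copy G H" "pair_digraph F"
    and "pverts G \<subseteq> pverts F" "parcs G \<subseteq> parcs F"
  shows "contains_copy F H"
proof -
  obtain K where K: "subgraph (with_proj K) (with_proj G)"
      "digraph_iso (with_proj H) (with_proj K)"
    using assms(1) unfolding contains_copy_def by blast
  interpret pair_digraph F by (rule assms(2))
  have "subgraph (with_proj G) (with_proj F)"
    using assms(3,4) K(1) wf_digraph_axioms
    unfolding subgraph_def compatible_def by simp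
  then show ?thesis using K subgraph_trans unfolding contains_copy_def by blast
qed

lemma expander_contains_copy:
  assumes F: "semicomplete F" and ne: "pverts F \<noteq> {}" and ex: "expander d F"
    and d: "2 * log 2 (real (card (pverts F))) + 6 \<le> d"
    and Q: "measure_pmf.prob (random_tournament F) Q < 1 / 2" and use: "useful H Q"
  shows "contains_copy F H"
proof -
  let ?R = "random_tournament F"
  let ?bad = "{G. \<not> prime_tournament G} \<union> Q"
  have "measure_pmf.prob ?R ?bad \<le>
      measure_pmf.prob ?R {G. \<not> prime_tournament G} + measure_pmf.prob ?R Q"
    by (rule measure_Un_le) auto
  also have "\<dots> < 1" using prob_not_prime_less_half[OF F ne ex d] Q by simp
  finally have "measure_pmf.prob ?R ?bad < 1" .
  then have "\<not> (\<forall>G\<in>set_pmf ?R. G \<in> ?bad)"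
    by (metis AE_measure_pmf_iff less_irrefl measure_pmf.prob_eq_1 sets_measure_pmf UNIV_I)
  then obtain c where c: "c \<in> set_pmf (coins F)" and "orient F c \<notin> ?bad"
    by (auto simp: random_tournament_eq)
  then have "contains_copy (orient F c) H" using use by (auto simp: useful_def)
  then show ?thesis
    using F tournament_orient(2)[OF F c]
    by (auto intro: contains_copy_mono simp: semicomplete_def)
qed

lemma semicomplete_induced:
  assumes F: "semicomplete F" and W: "W \<subseteq> pverts F"
  defines "G \<equiv> \<lparr>pverts = W, parcs = parcs F \<inter> W \<times> W\<rparr>"
  shows "semicomplete G" "bidirectional_pairs G = {e \<in> bidirectional_pairs F. e \<subseteq> W}"
proof -
  note arcs = semicomplete_arcs[OF F]
  have "pair_digraph G"
    using W arcs finite_subset by (intro pair_digraphI) (auto simp: G_def)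
  then show "semicomplete G"
    using W arcs(4) by (auto simp: semicomplete_def G_def)
  show "bidirectional_pairs G = {e \<in> bidirectional_pairs F. e \<subseteq> W}"
    unfolding bidirectional_pairs_def G_def by auto
qed

text \<open>
  The factor in front of \<open>n log n\<close> is the expansion \<open>d\<close>. Its first summand makes the expander
  found inside \<open>F\<close> subject to sparseness, the others make its random orientations prime. The
  expander may be much smaller than \<open>F\<close>, which does no harm because both requirements
  are monotone in the number of vertices.
\<close>

lemma contains_copy_if_many_bidirectional_pairs:
  fixes F :: "nat pair_pre_digraph"
  assumes F: "semicomplete F" and n: "card (pverts F) = n" "2 \<le> n" and b: "0 < b"
    and sparse: "\<And>G m. semicomplete G \<Longrightarrow> card (pverts G) = m \<Longrightarrow> 2 \<le> m \<Longrightarrow>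
      expander (b * log 2 (real m) powr b) G \<Longrightarrow>
      measure_pmf.prob (random_tournament G) Q < 1 / 2"
    and use: "useful H Q"
    and many: "(b * log 2 (real n) powr b + 2 * log 2 (real n) + 6) * real n * log 2 (real n)
      < real (card (bidirectional_pairs F))"
  shows "contains_copy F H"
proof -
  let ?U = "bidirectional_pairs F"
  define d where "d = b * log 2 (real n) powr b + 2 * log 2 (real n) + 6"
  have d0: "d \<ge> 0" using n b by (simp add: d_def)
  have U: "{e \<in> ?U. e \<subseteq> pverts F} = ?U" using bidirectional_pairs_card(2)[OF F] by auto
  obtain W where W: "W \<subseteq> pverts F" "2 \<le> card W" "graph_expander d W {e \<in> ?U. e \<subseteq> W}"
    using edges_le_if_no_expander[of "pverts F" ?U d] semicomplete_arcs(1)[OF F]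
      bidirectional_pairs_card(1)[OF F] d0
      many unfolding U n(1) d_def[symmetric] by (meson not_le)
  define G where "G = \<lparr>pverts = W, parcs = parcs F \<inter> W \<times> W\<rparr>"
  define m where "m = card W"
  have m: "2 \<le> m" "m \<le> n"
    using W n(1) card_mono[OF semicomplete_arcs(1)[OF F] W(1)] by (auto simp: m_def)
  have G: "semicomplete G" "bidirectional_pairs G = {e \<in> ?U. e \<subseteq> W}" "pverts G = W"
    using semicomplete_induced[OF F W(1)] by (simp_all add: G_def)
  have ex: "expander d G" using W(3) by (simp add: expander_def G)
  have log: "0 \<le> log 2 (real m)" "log 2 (real m) \<le> log 2 (real n)" using m by auto
  have pow: "b * log 2 (real m) powr b \<le> b * log 2 (real n) powr b"
    using log b by (intro mult_left_mono powr_mono2) auto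
  have "expander (b * log 2 (real m) powr b) G"
    using ex pow log unfolding expander_def by (elim graph_expander_mono) (simp add: d_def)
  then have "measure_pmf.prob (random_tournament G) Q < 1 / 2"
    using sparse[of G m] G m by (simp add: m_def)
  moreover have "2 * log 2 (real (card (pverts G))) + 6 \<le> d"
    using log(2) b by (simp add: d_def G m_def add_increasing)
  moreover have "pverts G \<noteq> {}" using m by (auto simp: G m_def)
  ultimately have "contains_copy G H" using expander_contains_copy[OF G(1) _ ex] use by blast
  then show ?thesis
    by (rule contains_copy_mono) (use F W(1) in \<open>auto simp: semicomplete_def G_def\<close>)
qed

section \<open>The number of added arcs\<close>

lemma tournament_add_reversals:
  assumes T: "tournament T" and A: "A \<subseteq> (parcs T)\<inverse>"
  defines "F \<equiv> T\<lparr>parcs := parcs T \<union> A\<rparr>"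
  shows "semicomplete F" "card A \<le> card (bidirectional_pairs F)"
proof -
  interpret pair_digraph T using T by (simp add: tournament_def)
  have arcs: "u \<in> pverts T" "v \<in> pverts T" "u \<noteq> v" if "(u, v) \<in> parcs T" for u v
    using arc_fst_in_verts[OF that] arc_snd_in_verts[OF that] pair_no_loops[OF that] by auto
  have "pair_digraph F"
    using pair_finite_verts A arcs by (intro pair_digraphI) (auto simp: F_def, blast+)
  moreover have "(u, v) \<in> parcs F \<or> (v, u) \<in> parcs F"
    if "u \<in> pverts F" "v \<in> pverts F" "u \<noteq> v" for u v
  proof -
    have "u \<in> pverts T" "v \<in> pverts T" using that by (simp_all add: F_def)
    then have "(u, v) \<in> parcs T \<or> (v, u) \<in> parcs T"
      using T that(3) unfolding tournament_def by blast
    then show ?thesis by (auto simp: F_def)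
  qed
  ultimately show F: "semicomplete F" unfolding semicomplete_def by blast
  have antisym: "(v, u) \<notin> parcs T" if "(u, v) \<in> parcs T" for u v
    using T arcs[OF that] that unfolding tournament_def by blast
  have "inj_on (\<lambda>(u, v). {u, v}) A"
  proof (rule inj_onI, clarify)
    fix u v x y assume uv: "(u, v) \<in> A" "(x, y) \<in> A" "{u, v} = {x, y}"
    then have "(v, u) \<in> parcs T" "(y, x) \<in> parcs T" using A by auto
    then show "u = x \<and> v = y" using antisym uv(3) by (auto simp: doubleton_eq_iff)
  qed
  moreover have "(\<lambda>(u, v). {u, v}) ` A \<subseteq> bidirectional_pairs F"
    using A by (auto simp: bidirectional_pairs_iff F_def)
  ultimately show "card A \<le> card (bidirectional_pairs F)"
    using finite_bidirectional_pairs[OF F] by (rule card_inj_on_le)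
qed

lemma eventually_polylog_bound:
  fixes b :: real
  assumes "0 < b"
  shows "\<forall>\<^sub>F n :: nat in sequentially.
    (b * log 2 (real n) powr b + 2 * log 2 (real n) + 6) * real n * log 2 (real n) + 1
      < real n * log 2 (real n) powr (b + 3)"
proof -
  have "filterlim (\<lambda>n :: nat. log 2 (real n)) at_top sequentially"
    by real_asymp
  then have "\<forall>\<^sub>F n :: nat in sequentially. b + 9 < log 2 (real n)"
    by (simp add: filterlim_at_top_dense)
  then show ?thesis
  proof (rule eventually_rev_mp, intro eventually_mono[OF eventually_gt_at_top[of 1]] impI)
    fix n :: nat assume n: "n > 1" and big: "b + 9 < log 2 (real n)"
    define L where "L = log 2 (real n)"
    define M where "M = L powr (b + 2)"
    have L: "L > b + 9" "L > 1" using big assms by (simp_all add: L_def)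
    have "L powr b * L = L powr (b + 1)" using L by (simp add: powr_add)
    also have "\<dots> \<le> M" unfolding M_def using L by (intro powr_mono) auto
    finally have t1: "b * (L powr b * L) \<le> b * M" using assms by simp
    have "L powr 2 \<le> M" unfolding M_def using L assms by (intro powr_mono) auto
    then have t2: "L * L \<le> M" using L by (simp add: powr_numeral power2_eq_square)
    have t3: "L \<le> M" using L t2 by (smt (verit) mult_le_cancel_left1)
    have "(b * L powr b + 2 * L + 6) * real n * L + 1 =
        real n * (b * (L powr b * L) + 2 * (L * L) + 6 * L) + 1"
      by (simp add: algebra_simps)
    also have "\<dots> \<le> real n * (b * M + 2 * M + 6 * M) + real n * M"
    proof (rule add_mono)
      show "real n * (b * (L powr b * L) + 2 * (L * L) + 6 * L) \<le> real n * (b * M + 2 * M + 6 * M)"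
        using t1 t2 t3 by (intro mult_left_mono) auto
      show "1 \<le> real n * M" using n L t3 by (smt (verit) mult_le_cancel_left1 of_nat_1 of_nat_less_iff)
    qed
    also have "\<dots> = real n * (M * (b + 9))" by (simp add: algebra_simps)
    also have "\<dots> < real n * (M * L)" using n L t3 by simp
    also have "M * L = L powr (b + 3)"
      using L by (simp add: M_def powr_add powr_numeral power_def field_simps numeral_eq_Suc)
    finally show "(b * log 2 (real n) powr b + 2 * log 2 (real n) + 6) * real n * log 2 (real n) + 1
      < real n * log 2 (real n) powr (b + 3)" by (simp add: L_def)
  qed
qed

theorem theorem2:
  fixes H :: "'a pair_pre_digraph"
  assumes "tournament H"
    and "\<exists>Q :: nat pair_pre_digraph set. (\<forall>G\<in>Q. tournament G) \<and> sparse_family Q \<and> useful H Q"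
  shows "\<exists>C :: real. \<forall>\<^sub>F n :: nat in sequentially.
           real (t_number n H) \<le> real n * log 2 (real n) powr C"
proof -
  obtain Q :: "nat pair_pre_digraph set" and b
    where use: "useful H Q" and b: "b > 0"
      and sparse: "\<And>F n. semicomplete F \<Longrightarrow> card (pverts F) = n \<Longrightarrow> 2 \<le> n \<Longrightarrow>
        expander (b * log 2 (real n) powr b) F \<Longrightarrow>
        measure_pmf.prob (random_tournament F) Q < 1 / 2"
    using assms(2) unfolding sparse_family_def by blast
  have "\<forall>\<^sub>F n :: nat in sequentially. real (t_number n H) \<le> real n * log 2 (real n) powr (b + 3)"
    using eventually_polylog_bound[OF b] eventually_ge_at_top[of 2]
  proof eventually_elim
    case (elim n)
    define t where "t = nat \<lfloor>real n * log 2 (real n) powr (b + 3)\<rfloor>"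
    have t: "real t \<le> real n * log 2 (real n) powr (b + 3)"
      "real n * log 2 (real n) powr (b + 3) < real t + 1"
      using elim(2) unfolding t_def by simp_all
    \<comment> \<open>The bound need not be an integer; rounding down costs the summand 1 in
      \<open>eventually_polylog_bound\<close>.\<close>
    have "contains_copy (T\<lparr>parcs := parcs T \<union> A\<rparr>) H"
      if T: "tournament T" "card (pverts T) = n" and A: "A \<subseteq> (parcs T)\<inverse>" "card A = t"
      for T :: "nat pair_pre_digraph" and A
    proof (rule contains_copy_if_many_bidirectional_pairs[OF _ _ elim(2) b sparse use])
      note F = tournament_add_reversals[OF T(1) A(1)]
      show "semicomplete (T\<lparr>parcs := parcs T \<union> A\<rparr>)" by (rule F(1))
      show "(b * log 2 (real n) powr b + 2 * log 2 (real n) + 6) * real n * log 2 (real n)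
          < real (card (bidirectional_pairs (T\<lparr>parcs := parcs T \<union> A\<rparr>)))"
        using F(2) A(2) t(2) elim(1) by linarith
    qed (use T in auto)
    then have "t_number n H \<le> t" unfolding t_number_def by (intro Least_le) blast
    then show ?case using t(1) by linarith
  qed
  then show ?thesis by blast
qed

end
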